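(* Let $q$ be a number with $0<|q|<1$, and let $a,b,c$ be real or complex parameters such that no denominator occurring below vanishes. Then Heine's basic hypergeometric function $\Phi[a,b;c;q,z]$ satisfies the following identities for $z\in\mathbb{D}=\{z\in\mathbb{C}:|z|<1\}$: (a) $$\Phi[a,b;c;q,z]-\Phi[a,bq;cq;q,z]=\frac{(1-a)(c-b)}{(1-c)(1-cq)}\,z\,\Phi[aq,bq;cq^2;q,z];$$ (b) $$\Phi[aq,b;c;q,z]-\Phi[a,b;c;q,z]=\frac{a(1-b)}{1-c}\,z\,\Phi[aq,bq;cq;q,z]=\frac{a}{1-a}\bigl(\Phi[a,b;c;q,z]-\Phi[a,b;c;q,qz]\bigr).$$
   Context: The $q$-shifted factorial is $(a;q)_0=1$, $(a;q)_n=(1-a)(1-aq)(1-aq^2)\cdots(1-aq^{n-1})$ for $n\ge 1$. Heine's (basic) hypergeometric function is, for $|q|<1$ and $z\in\mathbb{D}$, $$\Phi[a,b;c;q,z]=\sum_{n=0}^\infty\frac{(a;q)_n(b;q)_n}{(c;q)_n(q;q)_n}z^n,$$ where $a,b,c$ are real or complex parameters and $c$ is such that $(c;q)_n\neq 0$ for all $n$. In the last expression of (b), $a\ne1$ is understood. *)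

theory Defs
  imports "HOL-Analysis.Analysis"
begin

definition q_shifted_factorial :: "complex \<Rightarrow> complex \<Rightarrow> nat \<Rightarrow> complex"
  where "q_shifted_factorial a q n = (\<Prod>k<n. 1 - a * q ^ k)"

(* Meaningful for norm q < 1, norm z < 1 and q_shifted_factorial c q n \<noteq> 0 for all n. *)
definition Heine_Phi :: "complex \<Rightarrow> complex \<Rightarrow> complex \<Rightarrow> complex \<Rightarrow> complex \<Rightarrow> complex"
  where "Heine_Phi a b c q z =
    (\<Sum>n. q_shifted_factorial a q n * q_shifted_factorial b q n /
          (q_shifted_factorial c q n * q_shifted_factorial q q n) * z ^ n)"

end

theory Submission
  imports Defs
begin

text \<open>
  All three identities are statements about contiguous power series in \<open>z\<close>. The ratio of
  consecutive terms of such a series tends to \<open>z\<close>, so the series converge for \<open>|z| < 1\<close> and may be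
  subtracted term by term. In each difference the constant terms cancel, and it remains to compare
  its coefficient of \<open>z\<^bsup>n+1\<^esup>\<close> with the coefficient of \<open>z\<^bsup>n\<^esup>\<close> in the series with shifted
  parameters.

  Peeling the first factor off \<open>(a;q)\<^bsub>n+1\<^esub>\<close> gives \<open>(1 - a) (aq;q)\<^bsub>n\<^esub>\<close>, and peeling off the last one
  gives \<open>(a;q)\<^bsub>n\<^esub> (1 - a q\<^bsup>n\<^esup>)\<close>. Once the large products are matched in this way, each comparison is
  a polynomial identity in \<open>x = q\<^bsup>n+1\<^esup>\<close>:
  \<open>(1 - b) (1 - c x) - (1 - b x) (1 - c) = (c - b) (1 - x)\<close> for the first, and
  \<open>(1 - a x) - (1 - a) = a (1 - x)\<close> for the second; in the third, passing from \<open>z\<close> to \<open>q z\<close>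
  contributes \<open>1 - x\<close> directly. The factor \<open>1 - x\<close> then cancels the last factor of
  \<open>(q;q)\<^bsub>n+1\<^esub>\<close>, which accounts for the shift of the index.
\<close>

lemma q_shifted_factorial_0 [simp]: "q_shifted_factorial a q 0 = 1"
  by (simp add: q_shifted_factorial_def)

lemma q_shifted_factorial_Suc:
  "q_shifted_factorial a q (Suc n) = q_shifted_factorial a q n * (1 - a * q ^ n)"
  by (simp add: q_shifted_factorial_def)

lemma q_shifted_factorial_Suc_shift:
  "q_shifted_factorial a q (Suc n) = (1 - a) * q_shifted_factorial (a * q) q n"
  unfolding q_shifted_factorial_def
  by (subst prod.lessThan_Suc_shift) (simp add: mult.assoc)

lemma q_shifted_factorial_shift_nonzero:
  assumes "\<And>n. q_shifted_factorial c q n \<noteq> 0"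
  shows "q_shifted_factorial (c * q) q n \<noteq> 0"
  using assms[of "Suc n"] by (simp add: q_shifted_factorial_Suc_shift)

lemma one_minus_power_nonzero:
  fixes q :: complex
  assumes "norm q < 1"
  shows "1 - q ^ Suc n \<noteq> 0"
proof
  assume "1 - q ^ Suc n = 0"
  then have "norm q ^ Suc n = 1"
    by (metis eq_iff_diff_eq_0 norm_one norm_power)
  moreover have "norm q ^ Suc n < 1"
    using power_strict_mono[OF assms, of "Suc n"] by simp
  ultimately show False by simp
qed

lemma q_shifted_factorial_self_nonzero:
  assumes "norm q < 1"
  shows "q_shifted_factorial q q n \<noteq> 0"
  using one_minus_power_nonzero[OF assms]
  by (auto simp: q_shifted_factorial_def simp del: power_Suc simp flip: power_Suc)

definition Heine_coeff :: "complex \<Rightarrow> complex \<Rightarrow> complex \<Rightarrow> complex \<Rightarrow> nat \<Rightarrow> complex"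
  where "Heine_coeff a b c q n =
    q_shifted_factorial a q n * q_shifted_factorial b q n /
      (q_shifted_factorial c q n * q_shifted_factorial q q n)"

lemma Heine_Phi_eq_suminf: "Heine_Phi a b c q z = (\<Sum>n. Heine_coeff a b c q n * z ^ n)"
  by (simp add: Heine_Phi_def Heine_coeff_def)

lemma Heine_coeff_0 [simp]: "Heine_coeff a b c q 0 = 1"
  by (simp add: Heine_coeff_def)

lemma Heine_coeff_Suc:
  "Heine_coeff a b c q (Suc n) =
     (1 - a * q ^ n) * (1 - b * q ^ n) / ((1 - c * q ^ n) * (1 - q * q ^ n)) * Heine_coeff a b c q n"
  by (simp add: Heine_coeff_def q_shifted_factorial_Suc mult_ac)

text \<open>
  The ratio test applies, as the factor relating consecutive terms tends to \<open>z\<close>. It is used in the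
  multiplicative form, since the series terminates when \<open>(a;q)\<^bsub>n\<^esub>\<close> or \<open>(b;q)\<^bsub>n\<^esub>\<close> vanishes.
\<close>

lemma summable_Heine:
  assumes q: "norm q < 1" and z: "norm z < 1"
  shows "summable (\<lambda>n. Heine_coeff a b c q n * z ^ n)"
proof -
  define r where
    "r n = (1 - a * q ^ n) * (1 - b * q ^ n) / ((1 - c * q ^ n) * (1 - q * q ^ n)) * z" for n
  have power_lim: "(\<lambda>n. q ^ n) \<longlonglongrightarrow> 0"
    using q by (rule LIMSEQ_power_zero)
  have "r \<longlonglongrightarrow> (1 - a * 0) * (1 - b * 0) / ((1 - c * 0) * (1 - q * 0)) * z"
    unfolding r_def by (intro power_lim tendsto_mult tendsto_divide tendsto_diff tendsto_const) auto
  then have "(\<lambda>n. norm (r n)) \<longlonglongrightarrow> norm z"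
    by (simp add: tendsto_norm)
  moreover obtain \<rho> where \<rho>: "norm z < \<rho>" "\<rho> < 1"
    using dense[OF z] by blast
  ultimately have "eventually (\<lambda>n. norm (r n) < \<rho>) sequentially"
    by (auto dest: order_tendstoD)
  then obtain N where N: "\<And>n. n \<ge> N \<Longrightarrow> norm (r n) < \<rho>"
    by (auto simp: eventually_sequentially)
  show ?thesis
  proof (rule summable_ratio_test[OF \<rho>(2)])
    fix n assume "n \<ge> N"
    have "Heine_coeff a b c q (Suc n) * z ^ Suc n = r n * (Heine_coeff a b c q n * z ^ n)"
      by (simp add: Heine_coeff_Suc r_def)
    then show "norm (Heine_coeff a b c q (Suc n) * z ^ Suc n)
               \<le> \<rho> * norm (Heine_coeff a b c q n * z ^ n)"
      using N[OF \<open>n \<ge> N\<close>] by (simp only: norm_mult) (intro mult_right_mono; simp)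
  qed
qed

lemma suminf_diff_eq_shifted:
  fixes f g h :: "nat \<Rightarrow> 'a::real_normed_field"
  assumes "summable f" "summable g" "summable h"
    and "f 0 = g 0"
    and step: "\<And>n. f (Suc n) - g (Suc n) = K * h n"
  shows "suminf f - suminf g = K * suminf h"
proof -
  have "suminf f - suminf g = (\<Sum>n. f n - g n)"
    using assms by (simp add: suminf_diff)
  also have "\<dots> = (\<Sum>n. f (Suc n) - g (Suc n))"
    using suminf_split_head[of "\<lambda>n. f n - g n"] assms(1,2,4) by (simp add: summable_diff)
  also have "\<dots> = K * suminf h"
    using assms(3) by (simp add: step suminf_mult)
  finally show ?thesis .
qed

text \<open>
  The product \<open>(cq;q)\<^bsub>n+1\<^esub>\<close> links the three denominators: it contains \<open>(cq;q)\<^bsub>n\<^esub>\<close>, to which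
  \<open>(c;q)\<^bsub>n+1\<^esub>\<close> reduces, and also \<open>(cq\<^sup>2;q)\<^bsub>n\<^esub>\<close>, which occurs on the right. Over this common
  denominator the difference is \<open>(1 - b) (1 - c x) - (1 - b x) (1 - c)\<close> times known factors.
\<close>

lemma Heine_coeff_diff_bc:
  assumes q: "norm q < 1" and c: "\<And>n. q_shifted_factorial c q n \<noteq> 0"
  shows "Heine_coeff a b c q (Suc n) - Heine_coeff a (b * q) (c * q) q (Suc n) =
    (1 - a) * (c - b) / ((1 - c) * (1 - c * q)) * Heine_coeff (a * q) (b * q) (c * q\<^sup>2) q n"
proof -
  define x where "x = q ^ Suc n"
  define A where "A = q_shifted_factorial (a * q) q n"
  define B where "B = q_shifted_factorial (b * q) q n"
  define D where "D = q_shifted_factorial (c * q) q n"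
  define E where "E = q_shifted_factorial (c * q\<^sup>2) q n"
  define Q where "Q = q_shifted_factorial q q n"
  have sub:
    "q_shifted_factorial a q (Suc n) = (1 - a) * A"
    "q_shifted_factorial b q (Suc n) = (1 - b) * B"
    "q_shifted_factorial c q (Suc n) = (1 - c) * D"
    by (simp_all add: q_shifted_factorial_Suc_shift A_def B_def D_def)
  have last:
    "q_shifted_factorial (b * q) q (Suc n) = B * (1 - b * x)"
    "q_shifted_factorial (c * q) q (Suc n) = D * (1 - c * x)"
    "q_shifted_factorial q q (Suc n) = Q * (1 - x)"
    by (simp_all add: q_shifted_factorial_Suc B_def D_def Q_def x_def mult.assoc)
  have DE: "D * (1 - c * x) = (1 - c * q) * E"
    using last(2) q_shifted_factorial_Suc_shift[of "c * q" q n]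
    by (simp add: E_def power2_eq_square mult.assoc)
  have nz: "1 - c \<noteq> 0" "D \<noteq> 0" "1 - c * x \<noteq> 0" "Q \<noteq> 0" "1 - x \<noteq> 0"
    using c[of "Suc n"] q_shifted_factorial_shift_nonzero[OF c, of "Suc n"]
      q_shifted_factorial_self_nonzero[OF q, of "Suc n"]
    unfolding sub last by auto
  have "Heine_coeff a b c q (Suc n) - Heine_coeff a (b * q) (c * q) q (Suc n) =
      (1 - a) * A * ((1 - b) * B) / ((1 - c) * D * (Q * (1 - x)))
      - (1 - a) * A * (B * (1 - b * x)) / (D * (1 - c * x) * (Q * (1 - x)))"
    unfolding Heine_coeff_def sub last ..
  also have "\<dots> = (1 - a) * A * B / ((1 - c) * (D * (1 - c * x)) * (Q * (1 - x)))
      * ((1 - b) * (1 - c * x) - (1 - b * x) * (1 - c))"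
    using nz by (simp add: divide_simps) (simp add: algebra_simps)
  also have "(1 - b) * (1 - c * x) - (1 - b * x) * (1 - c) = (c - b) * (1 - x)"
    by (simp add: algebra_simps)
  also have "(1 - a) * A * B / ((1 - c) * (D * (1 - c * x)) * (Q * (1 - x))) * ((c - b) * (1 - x))
      = (1 - a) * (c - b) * A * B / ((1 - c) * (D * (1 - c * x)) * Q)"
    using nz by (simp add: mult_ac)
  also have "\<dots> = (1 - a) * (c - b) / ((1 - c) * (1 - c * q)) *
      Heine_coeff (a * q) (b * q) (c * q\<^sup>2) q n"
    unfolding DE Heine_coeff_def by (simp add: A_def B_def E_def Q_def mult_ac)
  finally show ?thesis .
qed

text \<open>
  The left-hand side is the coefficient of \<open>z\<^bsup>n+1\<^esup>\<close> in \<open>\<Phi>[a,b;c;q,z] - \<Phi>[a,b;c;q,qz]\<close>.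
\<close>

lemma Heine_coeff_times_one_minus_power:
  assumes q: "norm q < 1"
  shows "Heine_coeff a b c q (Suc n) * (1 - q ^ Suc n) =
    (1 - a) * (1 - b) / (1 - c) * Heine_coeff (a * q) (b * q) (c * q) q n"
  using one_minus_power_nonzero[OF q, of n]
  unfolding Heine_coeff_def q_shifted_factorial_Suc_shift[of a] q_shifted_factorial_Suc_shift[of b]
    q_shifted_factorial_Suc_shift[of c] q_shifted_factorial_Suc[of q] by simp

text \<open>
  The products \<open>(aq;q)\<^bsub>n+1\<^esub>\<close> and \<open>(a;q)\<^bsub>n+1\<^esub>\<close> share the factor \<open>(aq;q)\<^bsub>n\<^esub>\<close> and differ in
  \<open>1 - a q\<^bsup>n+1\<^esup>\<close> against \<open>1 - a\<close>.
\<close>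

lemma Heine_coeff_diff_a:
  assumes q: "norm q < 1"
  shows "Heine_coeff (a * q) b c q (Suc n) - Heine_coeff a b c q (Suc n) =
    a * (1 - b) / (1 - c) * Heine_coeff (a * q) (b * q) (c * q) q n"
proof -
  have "q_shifted_factorial (a * q) q (Suc n) - q_shifted_factorial a q (Suc n) =
      a * (1 - q ^ Suc n) * q_shifted_factorial (a * q) q n"
    unfolding q_shifted_factorial_Suc_shift[of a] q_shifted_factorial_Suc[of "a * q"]
    by (simp add: algebra_simps)
  then have "Heine_coeff (a * q) b c q (Suc n) - Heine_coeff a b c q (Suc n) =
      a * (1 - q ^ Suc n) * q_shifted_factorial (a * q) q n * q_shifted_factorial b q (Suc n) /
      (q_shifted_factorial c q (Suc n) * q_shifted_factorial q q (Suc n))"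
    unfolding Heine_coeff_def by (metis diff_divide_distrib left_diff_distrib)
  also have "\<dots> = a * (1 - b) / (1 - c) * Heine_coeff (a * q) (b * q) (c * q) q n"
    using one_minus_power_nonzero[OF q, of n]
    unfolding Heine_coeff_def q_shifted_factorial_Suc_shift[of b]
      q_shifted_factorial_Suc_shift[of c] q_shifted_factorial_Suc[of q] by simp
  finally show ?thesis .
qed

theorem lemma2p2:
  fixes a b c q z :: complex
  assumes q: "0 < norm q" "norm q < 1"
    and c: "\<And>n. q_shifted_factorial c q n \<noteq> 0"
    and z: "norm z < 1"
  shows
    "Heine_Phi a b c q z - Heine_Phi a (b * q) (c * q) q z
       = (1 - a) * (c - b) / ((1 - c) * (1 - c * q)) * z * Heine_Phi (a * q) (b * q) (c * q\<^sup>2) q z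
     \<and> Heine_Phi (a * q) b c q z - Heine_Phi a b c q z
       = a * (1 - b) / (1 - c) * z * Heine_Phi (a * q) (b * q) (c * q) q z
     \<and> (a \<noteq> 1 \<longrightarrow>
         a * (1 - b) / (1 - c) * z * Heine_Phi (a * q) (b * q) (c * q) q z
           = a / (1 - a) * (Heine_Phi a b c q z - Heine_Phi a b c q (q * z)))"
proof (intro conjI impI)
  note sums = summable_Heine[OF q(2) z]
  show "Heine_Phi a b c q z - Heine_Phi a (b * q) (c * q) q z
       = (1 - a) * (c - b) / ((1 - c) * (1 - c * q)) * z * Heine_Phi (a * q) (b * q) (c * q\<^sup>2) q z"
    unfolding Heine_Phi_eq_suminf
  proof (intro suminf_diff_eq_shifted sums)
    fix n
    show "Heine_coeff a b c q (Suc n) * z ^ Suc n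
        - Heine_coeff a (b * q) (c * q) q (Suc n) * z ^ Suc n
      = (1 - a) * (c - b) / ((1 - c) * (1 - c * q)) * z *
          (Heine_coeff (a * q) (b * q) (c * q\<^sup>2) q n * z ^ n)"
      unfolding left_diff_distrib[symmetric] Heine_coeff_diff_bc[OF q(2) c] by simp
  qed simp
  show "Heine_Phi (a * q) b c q z - Heine_Phi a b c q z
       = a * (1 - b) / (1 - c) * z * Heine_Phi (a * q) (b * q) (c * q) q z"
    unfolding Heine_Phi_eq_suminf
  proof (intro suminf_diff_eq_shifted sums)
    fix n
    show "Heine_coeff (a * q) b c q (Suc n) * z ^ Suc n - Heine_coeff a b c q (Suc n) * z ^ Suc n
      = a * (1 - b) / (1 - c) * z * (Heine_coeff (a * q) (b * q) (c * q) q n * z ^ n)"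
      unfolding left_diff_distrib[symmetric] Heine_coeff_diff_a[OF q(2)] by simp
  qed simp
  have qz: "norm (q * z) < 1"
    using mult_strict_mono'[OF q(2) z] by (simp add: norm_mult)
  have "Heine_Phi a b c q z - Heine_Phi a b c q (q * z)
      = (1 - a) * (1 - b) / (1 - c) * z * Heine_Phi (a * q) (b * q) (c * q) q z"
    unfolding Heine_Phi_eq_suminf
  proof (intro suminf_diff_eq_shifted sums summable_Heine[OF q(2) qz])
    fix n
    have "Heine_coeff a b c q (Suc n) * z ^ Suc n - Heine_coeff a b c q (Suc n) * (q * z) ^ Suc n
        = Heine_coeff a b c q (Suc n) * (1 - q ^ Suc n) * z ^ Suc n"
      unfolding power_mult_distrib by (simp add: algebra_simps)
    then show "Heine_coeff a b c q (Suc n) * z ^ Suc n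
        - Heine_coeff a b c q (Suc n) * (q * z) ^ Suc n
      = (1 - a) * (1 - b) / (1 - c) * z * (Heine_coeff (a * q) (b * q) (c * q) q n * z ^ n)"
      unfolding Heine_coeff_times_one_minus_power[OF q(2)] by simp
  qed simp
  then show "a * (1 - b) / (1 - c) * z * Heine_Phi (a * q) (b * q) (c * q) q z
      = a / (1 - a) * (Heine_Phi a b c q z - Heine_Phi a b c q (q * z))" if "a \<noteq> 1"
    using that by simp
qed

end
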